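(* Fix $d\ge1$, and let $\{\mathcal{M}_t,t\ge0\}=\{(M^x_t)_{x\in V},t\ge0\}$ be the meteor (mass) process on $G=C_n^d$ (the product of $d$ copies of the cycle $C_n$), under the stationary measure $Q_k$, where $k=|V|=n^d$ and $\sum_{x\in V}M^x_0=k$ under $Q_k$. Then $$\mathbb{E}_{Q_k}M^x_0=1,\qquad x\in V,$$ $$\lim_{k\to\infty}\operatorname{Var}_{Q_k}M^x_0=1,\qquad x\in V,$$ $$\lim_{k\to\infty}\operatorname{Cov}_{Q_k}(M^x_0,M^y_0)=-\frac1{2d},\qquad x\leftrightarrow y,$$ $$\lim_{k\to\infty}\operatorname{Cov}_{Q_k}(M^x_0,M^y_0)=0,\qquad x\ne y\text{ and }x\not\leftrightarrow y.$$
   Context: $C_n$ is the circular graph with vertices $1,\dots,n$ (indices mod $n$) and edges between cyclically consecutive vertices. $C_n^d$ is the discrete torus with vertex set $V$, $|V|=n^d$: two vertices are adjacent ($x\leftrightarrow y$) if and only if they differ in exactly one coordinate and those coordinates are adjacent in $C_n$. The limit $k\to\infty$ means $n\to\infty$ with $d$ fixed; $x$ and $y$ are fixed points of $\mathbb{Z}^d$, regarded as vertices of $C_n^d$ by reducing coordinates mod $n$, with adjacency understood for large $n$. Meteor process: let $N^v$, $v\in V$, be jointly independent rate 1 Poisson processes, independent of the nonnegative initial vector $\mathcal{M}_0$. At a jump time $t$ of $N^v$, $M^v_t=0$, $M^x_t=M^x_{t-}+M^v_{t-}/d_v$ for every $x\leftrightarrow v$ ($d_v$ is the degree of $v$), and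 all other masses are unchanged; masses are constant between jumps. For total mass $k=|V|$ this Markov process has a unique stationary distribution, denoted $Q_k$. *)

theory Defs
  imports "HOL-Probability.Probability"
begin

text \<open>The path conditions are required almost surely; the truncated subtraction in the
  increments is therefore harmless.\<close>

definition poisson_process :: "'a measure \<Rightarrow> real \<Rightarrow> (real \<Rightarrow> 'a \<Rightarrow> nat) \<Rightarrow> bool" where
  "poisson_process \<Omega> r N \<longleftrightarrow>
     (\<forall>t\<ge>0. N t \<in> measurable \<Omega> (count_space UNIV)) \<and>
     (AE \<omega> in \<Omega>. N 0 \<omega> = 0 \<and> mono_on {0..} (\<lambda>t. N t \<omega>) \<and>
        (\<forall>t\<ge>0. continuous (at_right t) (\<lambda>s. N s \<omega>))) \<and>
     (\<forall>s\<ge>0. \<forall>t>s. distr \<Omega> (count_space UNIV) (\<lambda>\<omega>. N t \<omega> - N s \<omega>)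
        = measure_pmf (poisson_pmf (r * (t - s)))) \<and>
     (\<forall>(m::nat) \<tau>. 0 \<le> \<tau> 0 \<and> mono \<tau> \<longrightarrow>
        prob_space.indep_vars \<Omega> (\<lambda>_. count_space UNIV)
          (\<lambda>i \<omega>. N (\<tau> (Suc i)) \<omega> - N (\<tau> i) \<omega>) {..<m})"

text \<open>A simple graph is given by a finite vertex set \<open>V\<close> and an irreflexive symmetric
  adjacency relation \<open>E\<close>.\<close>

definition graph_degree :: "'v set \<Rightarrow> ('v \<Rightarrow> 'v \<Rightarrow> bool) \<Rightarrow> 'v \<Rightarrow> nat" where
  "graph_degree V E v = card {x \<in> V. E v x}"

definition jump_time :: "(real \<Rightarrow> nat) \<Rightarrow> real \<Rightarrow> bool" where
  "jump_time f t \<longleftrightarrow> 0 < t \<and> Lim (at_left t) f \<noteq> f t"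

definition meteor_path ::
  "'v set \<Rightarrow> ('v \<Rightarrow> 'v \<Rightarrow> bool) \<Rightarrow> ('v \<Rightarrow> real \<Rightarrow> nat) \<Rightarrow> (real \<Rightarrow> 'v \<Rightarrow> real) \<Rightarrow> bool" where
  "meteor_path V E n m \<longleftrightarrow>
     (\<forall>v\<in>V. \<forall>t. jump_time (n v) t \<longrightarrow>
        m t v = 0 \<and>
        (\<forall>x\<in>V. E v x \<longrightarrow>
           m t x = Lim (at_left t) (\<lambda>s. m s x)
                 + Lim (at_left t) (\<lambda>s. m s v) / real (graph_degree V E v)) \<and>
        (\<forall>x\<in>V. x \<noteq> v \<and> \<not> E v x \<longrightarrow> m t x = Lim (at_left t) (\<lambda>s. m s x))) \<and>
     (\<forall>s\<ge>0. \<forall>t>s. (\<forall>v\<in>V. \<forall>u. s < u \<and> u \<le> t \<longrightarrow> \<not> jump_time (n v) u) \<longrightarrow>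
        (\<forall>x\<in>V. m t x = m s x))"

abbreviation mass_space :: "'v set \<Rightarrow> ('v \<Rightarrow> real) measure" where
  "mass_space V \<equiv> Pi\<^sub>M V (\<lambda>_. borel)"

abbreviation clock_space :: "(real \<Rightarrow> nat) measure" where
  "clock_space \<equiv> Pi\<^sub>M {0..} (\<lambda>_. count_space UNIV)"

text \<open>The dynamics can only be imposed almost surely, since two clocks may ring at the same
  time on a null set. The index \<open>None\<close> stands for the \<open>\<sigma>\<close>-algebra generated by the initial
  masses and \<open>Some v\<close> for the one generated by the whole path of the clock at \<open>v\<close>.\<close>

definition meteor_process ::
  "'a measure \<Rightarrow> 'v set \<Rightarrow> ('v \<Rightarrow> 'v \<Rightarrow> bool) \<Rightarrow> ('v \<Rightarrow> real \<Rightarrow> 'a \<Rightarrow> nat) \<Rightarrow>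
    (real \<Rightarrow> 'v \<Rightarrow> 'a \<Rightarrow> real) \<Rightarrow> bool" where
  "meteor_process \<Omega> V E N M \<longleftrightarrow>
     prob_space \<Omega> \<and>
     (\<forall>v\<in>V. poisson_process \<Omega> 1 (N v)) \<and>
     (\<forall>t\<ge>0. \<forall>x\<in>V. M t x \<in> borel_measurable \<Omega>) \<and>
     prob_space.indep_sets \<Omega>
       (\<lambda>i. case i of
          None \<Rightarrow> sets (vimage_algebra (space \<Omega>) (\<lambda>\<omega>. \<lambda>x\<in>V. M 0 x \<omega>) (mass_space V))
        | Some v \<Rightarrow> sets (vimage_algebra (space \<Omega>) (\<lambda>\<omega>. \<lambda>t\<in>{0..}. N v t \<omega>) clock_space))
       (insert None (Some ` V)) \<and>
     (AE \<omega> in \<Omega>. \<forall>x\<in>V. 0 \<le> M 0 x \<omega>) \<and>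
     (AE \<omega> in \<Omega>. meteor_path V E (\<lambda>v t. N v t \<omega>) (\<lambda>t x. M t x \<omega>))"

definition stationary_meteor_process ::
  "'a measure \<Rightarrow> 'v set \<Rightarrow> ('v \<Rightarrow> 'v \<Rightarrow> bool) \<Rightarrow> ('v \<Rightarrow> real \<Rightarrow> 'a \<Rightarrow> nat) \<Rightarrow>
    (real \<Rightarrow> 'v \<Rightarrow> 'a \<Rightarrow> real) \<Rightarrow> real \<Rightarrow> ('v \<Rightarrow> real) measure \<Rightarrow> bool" where
  "stationary_meteor_process \<Omega> V E N M k Q \<longleftrightarrow>
     meteor_process \<Omega> V E N M \<and>
     (\<forall>t\<ge>0. distr \<Omega> (mass_space V) (\<lambda>\<omega>. \<lambda>x\<in>V. M t x \<omega>) = Q) \<and>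
     (AE \<omega> in \<Omega>. (\<Sum>x\<in>V. M 0 x \<omega>) = k)"

text \<open>The vertices of the cycle are represented by the residues \<open>0, \<dots>, n - 1\<close> instead of
  \<open>1, \<dots>, n\<close>. The cycle is a simple graph: there is no loop for \<open>n = 1\<close> and only a single
  edge for \<open>n = 2\<close>.\<close>

definition cycle_adj :: "nat \<Rightarrow> int \<Rightarrow> int \<Rightarrow> bool" where
  "cycle_adj n a b \<longleftrightarrow> a \<noteq> b \<and> (b = (a + 1) mod int n \<or> a = (b + 1) mod int n)"

definition torus :: "nat \<Rightarrow> (int ^ 'd) set" where
  "torus n = {x. \<forall>i. 0 \<le> x $ i \<and> x $ i < int n}"

definition torus_adj :: "nat \<Rightarrow> int ^ 'd \<Rightarrow> int ^ 'd \<Rightarrow> bool" where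
  "torus_adj n x y \<longleftrightarrow> (\<exists>i. cycle_adj n (x $ i) (y $ i) \<and> (\<forall>j. j \<noteq> i \<longrightarrow> x $ j = y $ j))"

definition reduce :: "nat \<Rightarrow> int ^ 'd \<Rightarrow> int ^ 'd" where
  "reduce n x = (\<chi> i. x $ i mod int n)"

definition covariance :: "'a measure \<Rightarrow> ('a \<Rightarrow> real) \<Rightarrow> ('a \<Rightarrow> real) \<Rightarrow> real" where
  "covariance P X Y = prob_space.expectation P
     (\<lambda>\<omega>. (X \<omega> - prob_space.expectation P X) * (Y \<omega> - prob_space.expectation P Y))"

end

theory Submission
  imports Defs "HOL-Real_Asymp.Real_Asymp"
begin

text \<open>On any finite connected \<open>D\<close>-regular graph on which the total mass equals the number of
vertices, a stationary law has second moments
\<open>E (m x * m y) = 1 + [x = y] - [x \<sim> y] / D\<close> exactly. The torus is \<open>2d\<close>-regular as soon as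
\<open>n \<ge> 3\<close>, so the variance and the covariances in question are equal to their limits for all large \<open>n\<close>.

Three observations lead to this formula. First, all clocks have the same rate. Within a short time
\<open>t\<close>, up to probability \<open>O(t\<^sup>2)\<close>, either nothing happens or a single meteor hits a vertex whose
choice is independent of the current masses. Comparing the laws at the times \<open>0\<close> and \<open>t\<close> to first order in
\<open>t\<close> shows that a stationary law is invariant, in mean, under a hit at a uniformly chosen vertex
(\<open>stationary_hit_identity\<close>).

Secondly, a hit acts linearly on the masses, so this invariance, applied to \<open>m x * m y\<close>, is a closed
linear system for the second moments \<open>K x y\<close>. Its coefficients are the transition probabilities
of a Markov chain on pairs of vertices: think of two particles, each of which jumps to a uniform
neighbour when its vertex is hit, the two jumps being independent also when the particles share a vertex. Thus \<open>K\<close>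
is an invariant measure of this chain. Every state leads to any given diagonal state, because
one particle can walk to the other and then both can travel together; hence the invariant measure is
determined by its total mass, which is \<open>E ((\<Sum>x. m x)\<^sup>2) = (card V)\<^sup>2\<close> (\<open>pair_moment_unique\<close>).

Thirdly, the solution can be guessed. Let \<open>P\<close> be the transition matrix of simple random walk. If
\<open>K\<close> has the constant diagonal \<open>a\<close>, the system reads \<open>P K + K P - 2 K - 2 a P + a P\<^sup>2 + a I = 0\<close>, and it is
solved by \<open>K = a (J + I - P) / 2\<close> with \<open>J\<close> the all-ones matrix; the total mass forces \<open>a = 2\<close>.
The mean is read off from the row sums of \<open>K\<close>, since \<open>\<Sum>x. K x y\<close> is the expectation of the
constant total mass times \<open>m y\<close>.\<close>

section \<open>The second moments as an invariant measure of a two-particle chain\<close>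

text \<open>A signed invariant measure satisfies \<open>\<bar>h\<bar> \<le> \<bar>h\<bar> p\<close>, and both sides have the same total because \<open>p\<close> is stochastic;
so \<open>\<bar>h\<bar>\<close> is invariant too, and so are the nonnegative measures \<open>\<bar>h\<bar> + h\<close> and \<open>\<bar>h\<bar> - h\<close>. A nonzero
nonnegative invariant measure charges every state that can be reached from its support, in particular \<open>c\<close>, but
\<open>\<bar>h\<bar> + h\<close> and \<open>\<bar>h\<bar> - h\<close> cannot both charge \<open>c\<close>. Hence \<open>h\<close> has a constant sign, and its vanishing
total makes it zero.\<close>
lemma invariant_zero_sum_measure_eq_zero:
  fixes p :: "'s \<Rightarrow> 's \<Rightarrow> real" and h :: "'s \<Rightarrow> real"
  assumes fin: "finite S"
    and nonneg: "\<And>s t. s \<in> S \<Longrightarrow> t \<in> S \<Longrightarrow> 0 \<le> p s t"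
    and stoch: "\<And>s. s \<in> S \<Longrightarrow> (\<Sum>t\<in>S. p s t) = 1"
    and inv: "\<And>t. t \<in> S \<Longrightarrow> h t = (\<Sum>s\<in>S. h s * p s t)"
    and total: "(\<Sum>s\<in>S. h s) = 0"
    and reach: "\<And>s. s \<in> S \<Longrightarrow> (\<lambda>s t. t \<in> S \<and> 0 < p s t)\<^sup>*\<^sup>* s c"
    and s: "s \<in> S"
  shows "h s = 0"
proof -
  have le: "\<bar>h t\<bar> \<le> (\<Sum>s\<in>S. \<bar>h s\<bar> * p s t)" if "t \<in> S" for t
  proof -
    have "\<bar>h t\<bar> \<le> (\<Sum>s\<in>S. \<bar>h s * p s t\<bar>)"
      using inv[OF that] sum_abs[of "\<lambda>s. h s * p s t" S] by simp
    also have "\<dots> = (\<Sum>s\<in>S. \<bar>h s\<bar> * p s t)"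
      using nonneg that by (intro sum.cong) (auto simp: abs_mult)
    finally show ?thesis .
  qed
  have "(\<Sum>t\<in>S. \<Sum>s\<in>S. \<bar>h s\<bar> * p s t) = (\<Sum>s\<in>S. \<bar>h s\<bar> * (\<Sum>t\<in>S. p s t))"
    by (subst sum.swap) (simp add: sum_distrib_left)
  also have "\<dots> = (\<Sum>s\<in>S. \<bar>h s\<bar>)" using stoch by simp
  finally have "(\<Sum>t\<in>S. (\<Sum>s\<in>S. \<bar>h s\<bar> * p s t) - \<bar>h t\<bar>) = 0"
    by (simp add: sum_subtractf)
  \<comment> \<open>Both sides of the termwise inequality have the same total, so it is an equality.\<close>
  then have abs_inv: "\<bar>h t\<bar> = (\<Sum>s\<in>S. \<bar>h s\<bar> * p s t)" if "t \<in> S" for t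
    using le that fin by (subst (asm) sum_nonneg_eq_0_iff) auto
  \<comment> \<open>Positivity at one state spreads along the transitions of positive probability.\<close>
  have spread: "0 < g c"
    if g0: "\<And>s. s \<in> S \<Longrightarrow> 0 \<le> g s" and ginv: "\<And>t. t \<in> S \<Longrightarrow> g t = (\<Sum>s\<in>S. g s * p s t)"
      and a: "a \<in> S" "0 < g a" for g :: "'s \<Rightarrow> real" and a
  proof -
    have "c \<in> S \<and> 0 < g c" using reach[OF a(1)]
    proof (induction rule: rtranclp_induct)
      case base
      then show ?case using a by simp
    next
      case (step y z)
      have "0 < (\<Sum>s\<in>S. g s * p s z)"
        using step g0 nonneg fin by (intro sum_pos2[of S y]) auto
      then show ?case using step ginv by simp
    qed
    then show ?thesis by simp
  qed
  have plus: "0 < \<bar>h c\<bar> + h c" if "a \<in> S" "0 < h a" for a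
  proof (rule spread[of "\<lambda>s. \<bar>h s\<bar> + h s" a])
    show "\<bar>h t\<bar> + h t = (\<Sum>s\<in>S. (\<bar>h s\<bar> + h s) * p s t)" if "t \<in> S" for t
      unfolding distrib_right sum.distrib by (simp only: abs_inv[OF that, symmetric] inv[OF that, symmetric])
  qed (use that in auto)
  have minus: "0 < \<bar>h c\<bar> - h c" if "a \<in> S" "h a < 0" for a
  proof (rule spread[of "\<lambda>s. \<bar>h s\<bar> - h s" a])
    show "\<bar>h t\<bar> - h t = (\<Sum>s\<in>S. (\<bar>h s\<bar> - h s) * p s t)" if "t \<in> S" for t
      unfolding left_diff_distrib sum_subtractf by (simp only: abs_inv[OF that, symmetric] inv[OF that, symmetric])
  qed (use that in auto)
  consider "\<forall>a\<in>S. 0 \<le> h a" | "\<forall>a\<in>S. h a \<le> 0"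
    using plus minus by (cases "h c > 0") fastforce+
  then show ?thesis
  proof cases
    case 1
    then show ?thesis using total s fin by (simp add: sum_nonneg_eq_0_iff)
  next
    case 2
    then show ?thesis using total s fin sum_nonneg_eq_0_iff[of S "\<lambda>s. - h s"] by (simp add: sum_negf)
  qed
qed

locale regular_graph =
  fixes V :: "'v set" and E :: "'v \<Rightarrow> 'v \<Rightarrow> bool" and D :: nat
  assumes finite_V: "finite V"
    and adj_irrefl: "\<not> E v v"
    and adj_sym: "E u v \<Longrightarrow> E v u"
    and degree: "v \<in> V \<Longrightarrow> graph_degree V E v = D"
    and D_pos: "0 < D"
    and connected: "u \<in> V \<Longrightarrow> w \<in> V \<Longrightarrow> (\<lambda>x y. y \<in> V \<and> E x y)\<^sup>*\<^sup>* u w"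
begin

definition hit :: "'v \<Rightarrow> ('v \<Rightarrow> real) \<Rightarrow> 'v \<Rightarrow> real" where
  "hit v m x = (if x = v then 0 else m x + (if E v x then m v / real D else 0))"

text \<open>A particle at \<open>u\<close> stays there unless \<open>u\<close> itself is the vertex \<open>v\<close> that is hit. This is the
matrix of the linear map \<open>hit v\<close>, see \<open>hit_eq_sum\<close>.\<close>
definition jump_prob :: "'v \<Rightarrow> 'v \<Rightarrow> 'v \<Rightarrow> real" where
  "jump_prob v u x = (if u = v then of_bool (E v x) / real D else of_bool (x = u))"

definition pair_prob :: "'v \<times> 'v \<Rightarrow> 'v \<times> 'v \<Rightarrow> real" where
  "pair_prob = (\<lambda>(u, w) (x, y). (\<Sum>v\<in>V. jump_prob v u x * jump_prob v w y) / real (card V))"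

text \<open>The matrix \<open>J + I - P\<close> with all-ones matrix \<open>J\<close> and simple random walk matrix \<open>P\<close>.\<close>
definition pair_moment :: "'v \<Rightarrow> 'v \<Rightarrow> real" where
  "pair_moment x y = 1 + of_bool (x = y) - of_bool (E x y) / real D"

lemma sum_adj: "v \<in> V \<Longrightarrow> (\<Sum>x\<in>V. of_bool (E v x)) = real D"
  using degree[of v] finite_V unfolding graph_degree_def
  by (simp add: sum.If_cases of_bool_def Int_def)

lemma adj_commute: "E u v = E v u" using adj_sym by blast

lemma hit_eq_sum:
  assumes "v \<in> V" "x \<in> V"
  shows "hit v m x = (\<Sum>u\<in>V. m u * jump_prob v u x)"
proof -
  have "(\<Sum>u\<in>V. m u * jump_prob v u x)
      = (\<Sum>u\<in>V. (if u = v then m u * of_bool (E v x) / real D else 0)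
          + (if u = x then m u * of_bool (x \<noteq> v) else 0))"
    by (intro sum.cong) (auto simp: jump_prob_def)
  also have "\<dots> = hit v m x"
    using assms finite_V adj_irrefl by (auto simp: sum.distrib hit_def)
  finally show ?thesis by simp
qed

lemma jump_prob_nonneg: "0 \<le> jump_prob v u x"
  by (simp add: jump_prob_def)

lemma sum_jump_prob:
  assumes "v \<in> V" "u \<in> V"
  shows "(\<Sum>x\<in>V. jump_prob v u x) = 1"
proof (cases "u = v")
  case True
  then have "(\<Sum>x\<in>V. jump_prob v u x) = (\<Sum>x\<in>V. of_bool (E v x)) / real D"
    by (simp add: jump_prob_def sum_divide_distrib)
  then show ?thesis using sum_adj[OF assms(1)] D_pos by simp
next
  case False
  then show ?thesis using assms finite_V by (simp add: jump_prob_def)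
qed

lemma pair_prob_nonneg: "0 \<le> pair_prob s t"
  by (auto simp: pair_prob_def jump_prob_nonneg split: prod.splits intro!: sum_nonneg divide_nonneg_nonneg mult_nonneg_nonneg)

lemma sum_pair_prob:
  assumes "s \<in> V \<times> V"
  shows "(\<Sum>t\<in>V \<times> V. pair_prob s t) = 1"
proof -
  obtain u w where s: "s = (u, w)" "u \<in> V" "w \<in> V" using assms by auto
  have "(\<Sum>t\<in>V \<times> V. pair_prob s t)
      = (\<Sum>x\<in>V. \<Sum>y\<in>V. (\<Sum>v\<in>V. jump_prob v u x * jump_prob v w y)) / real (card V)"
    by (simp add: s pair_prob_def sum.cartesian_product' sum_divide_distrib)
  also have "(\<Sum>x\<in>V. \<Sum>y\<in>V. (\<Sum>v\<in>V. jump_prob v u x * jump_prob v w y))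
      = (\<Sum>x\<in>V. \<Sum>v\<in>V. \<Sum>y\<in>V. jump_prob v u x * jump_prob v w y)"
    by (intro sum.cong refl sum.swap)
  also have "\<dots> = (\<Sum>v\<in>V. \<Sum>x\<in>V. \<Sum>y\<in>V. jump_prob v u x * jump_prob v w y)"
    by (rule sum.swap)
  also have "\<dots> = (\<Sum>v\<in>V. (\<Sum>x\<in>V. jump_prob v u x) * (\<Sum>y\<in>V. jump_prob v w y))"
    by (simp add: sum_product)
  also have "\<dots> = real (card V)" using s by (simp add: sum_jump_prob)
  finally show ?thesis using s finite_V by (auto simp: card_gt_0_iff)
qed

lemma pair_prob_pos:
  assumes "v \<in> V" "0 < jump_prob v u x" "0 < jump_prob v w y"
  shows "0 < pair_prob (u, w) (x, y)"
proof -
  have "0 < (\<Sum>v\<in>V. jump_prob v u x * jump_prob v w y)"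
    using assms finite_V jump_prob_nonneg by (intro sum_pos2[of V v]) auto
  moreover have "0 < real (card V)" using assms finite_V by (auto simp: card_gt_0_iff)
  ultimately show ?thesis by (simp add: pair_prob_def)
qed

text \<open>While the particles are apart, hits at the vertex of the first one move it alone, along a path to the second
one. Once they share a vertex, every hit there may send both to the same neighbour.\<close>
lemma pair_reaches_diagonal_point:
  assumes "s \<in> V \<times> V" "c \<in> V"
  shows "(\<lambda>s t. t \<in> V \<times> V \<and> 0 < pair_prob s t)\<^sup>*\<^sup>* s (c, c)"
proof -
  obtain u w where s: "s = (u, w)" "u \<in> V" "w \<in> V" using assms by auto
  let ?R = "\<lambda>s t. t \<in> V \<times> V \<and> 0 < pair_prob s t"
  have meet: "?R\<^sup>*\<^sup>* (u, w) (w, w)"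
    using connected[OF s(2,3)] s(2)
  proof (induction rule: converse_rtranclp_induct)
    case base
    show ?case by simp
  next
    case (step y z)
    show ?case
    proof (cases "y = w")
      case False
      then have "0 < pair_prob (y, w) (z, w)"
        using step D_pos by (intro pair_prob_pos[of y]) (auto simp: jump_prob_def)
      then have "?R (y, w) (z, w)" using step s by auto
      moreover have "?R\<^sup>*\<^sup>* (z, w) (w, w)" using step by simp
      ultimately show ?thesis by (rule converse_rtranclp_into_rtranclp)
    qed simp
  qed
  have "?R\<^sup>*\<^sup>* (w, w) (c, c) \<and> c \<in> V" using connected[OF s(3) assms(2)]
  proof (induction rule: rtranclp_induct)
    case base
    show ?case using s by simp
  next
    case (step y z)
    have "0 < pair_prob (y, y) (z, z)"
      using step D_pos by (intro pair_prob_pos[of y]) (auto simp: jump_prob_def)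
    then have R: "?R (y, y) (z, z)" using step s by auto
    have "?R\<^sup>*\<^sup>* (w, w) (y, y)" using step by simp
    then have "?R\<^sup>*\<^sup>* (w, w) (z, z)" using R by (rule rtranclp.rtrancl_into_rtrancl)
    then show ?case using step by simp
  qed
  with meet show ?thesis unfolding s by (meson rtranclp_trans)
qed

text \<open>The two applications of \<open>hit v\<close> push both coordinates of \<open>pair_moment\<close> through a hit at \<open>v\<close>. If
\<open>v\<close> is adjacent to both \<open>x\<close> and \<open>y\<close>, the diagonal term \<open>2 / D\<^sup>2\<close> cancels the correction
\<open>- 1 / D\<^sup>2\<close> that each of the two cross terms carries. What remains is linear in the adjacencies, which is why only
the degree of the graph enters.\<close>
lemma hit_hit_pair_moment:
  assumes "v \<in> V" "x \<in> V" "y \<in> V"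
  shows "hit v (\<lambda>u. hit v (pair_moment u) y) x
    = pair_moment x y + (of_bool (E v x) + of_bool (E v y)) / real D - of_bool (v = x) - of_bool (v = y)"
  using D_pos adj_irrefl adj_commute[of x v] adj_commute[of x y] adj_commute[of y v]
  by (auto simp: hit_def pair_moment_def field_simps)

lemma sum_pair_prob_eq:
  "(\<Sum>s\<in>V \<times> V. case_prod K s * pair_prob s (x, y))
    = (\<Sum>v\<in>V. \<Sum>u\<in>V. \<Sum>w\<in>V. K u w * (jump_prob v u x * jump_prob v w y)) / real (card V)"
proof -
  have "(\<Sum>v\<in>V. \<Sum>u\<in>V. \<Sum>w\<in>V. K u w * (jump_prob v u x * jump_prob v w y))
    = (\<Sum>u\<in>V. \<Sum>v\<in>V. \<Sum>w\<in>V. K u w * (jump_prob v u x * jump_prob v w y))"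
    by (rule sum.swap)
  also have "\<dots> = (\<Sum>u\<in>V. \<Sum>w\<in>V. K u w * (\<Sum>v\<in>V. jump_prob v u x * jump_prob v w y))"
    unfolding sum_distrib_left by (intro sum.cong refl sum.swap)
  finally show ?thesis
    by (simp add: pair_prob_def sum.cartesian_product' sum_divide_distrib[symmetric])
qed

text \<open>Summed over \<open>v\<close>, the two adjacency terms of \<open>hit_hit_pair_moment\<close> contribute \<open>D / D\<close> each and balance the
losses at \<open>v = x\<close> and \<open>v = y\<close>.\<close>
lemma pair_moment_invariant:
  assumes "x \<in> V" "y \<in> V"
  shows "pair_moment x y = (\<Sum>s\<in>V \<times> V. case_prod pair_moment s * pair_prob s (x, y))"
proof -
  have deg: "(\<Sum>v\<in>V. of_bool (E x v) + of_bool (E y v)) / real D = 2"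
    using assms D_pos unfolding sum.distrib by (simp only: sum_adj) simp
  have "(\<Sum>v\<in>V. \<Sum>u\<in>V. \<Sum>w\<in>V. pair_moment u w * (jump_prob v u x * jump_prob v w y))
      = (\<Sum>v\<in>V. hit v (\<lambda>u. hit v (pair_moment u) y) x)"
    using assms by (intro sum.cong refl) (simp add: hit_eq_sum sum_distrib_right sum_distrib_left mult_ac)
  also have "\<dots> = (\<Sum>v\<in>V. pair_moment x y + (of_bool (E x v) + of_bool (E y v)) / real D
      - of_bool (v = x) - of_bool (v = y))"
    using assms by (intro sum.cong refl) (simp add: hit_hit_pair_moment adj_commute)
  also have "\<dots> = real (card V) * pair_moment x y
      + (\<Sum>v\<in>V. of_bool (E x v) + of_bool (E y v)) / real D - 2"
    using assms finite_V
    unfolding sum_subtractf sum.distrib[of "\<lambda>_. pair_moment x y"] sum_divide_distrib by simp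
  finally show ?thesis
    unfolding sum_pair_prob_eq using assms finite_V deg by auto
qed

lemma sum_pair_moment:
  assumes "y \<in> V"
  shows "(\<Sum>x\<in>V. pair_moment x y) = real (card V)"
proof -
  have "(\<Sum>x\<in>V. of_bool (E x y) / real D) = 1"
    using sum_adj[OF assms] D_pos by (simp only: adj_commute[of _ y] sum_divide_distrib[symmetric]) simp
  then show ?thesis
    using assms finite_V by (simp add: pair_moment_def sum.distrib sum_subtractf)
qed

lemma pair_moment_unique:
  assumes inv: "\<And>x y. x \<in> V \<Longrightarrow> y \<in> V \<Longrightarrow>
      real (card V) * K x y = (\<Sum>v\<in>V. \<Sum>u\<in>V. \<Sum>w\<in>V. K u w * (jump_prob v u x * jump_prob v w y))"
    and total: "(\<Sum>x\<in>V. \<Sum>y\<in>V. K x y) = (real (card V))\<^sup>2"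
    and "x \<in> V" "y \<in> V"
  shows "K x y = pair_moment x y"
proof -
  have V0: "real (card V) \<noteq> 0" using assms finite_V by auto
  define h where "h = (\<lambda>(u, w). K u w - pair_moment u w)"
  have K_inv: "K x y = (\<Sum>s\<in>V \<times> V. case_prod K s * pair_prob s (x, y))"
    if "x \<in> V" "y \<in> V" for x y
    using inv[OF that] V0 unfolding sum_pair_prob_eq by (simp add: eq_divide_eq mult.commute)
  have "h (x, y) = 0"
  proof (rule invariant_zero_sum_measure_eq_zero[where S = "V \<times> V" and p = pair_prob and c = "(x, x)"])
    show "finite (V \<times> V)" using finite_V by simp
    show "h t = (\<Sum>s\<in>V \<times> V. h s * pair_prob s t)" if tV: "t \<in> V \<times> V" for t
    proof -
      obtain a b where t: "t = (a, b)" "a \<in> V" "b \<in> V" using tV by auto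
      show ?thesis using K_inv[OF t(2,3)] pair_moment_invariant[OF t(2,3)]
        by (simp add: t(1) h_def split_beta left_diff_distrib sum_subtractf)
    qed
    have "(\<Sum>u\<in>V. \<Sum>w\<in>V. pair_moment u w) = (real (card V))\<^sup>2"
      by (subst sum.swap) (simp add: sum_pair_moment power2_eq_square)
    then show "sum h (V \<times> V) = 0"
      using total by (simp add: h_def sum.cartesian_product[symmetric] sum_subtractf)
  qed (use assms sum_pair_prob pair_prob_nonneg pair_reaches_diagonal_point in auto)
  then show ?thesis by (simp add: h_def)
qed

end

section \<open>Trajectories with at most one meteor\<close>

lemma Lim_at_left_eqI:
  fixes f :: "real \<Rightarrow> 'b::t2_space"
  assumes "a < t" "\<And>s. a < s \<Longrightarrow> s < t \<Longrightarrow> f s = c"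
  shows "Lim (at_left t) f = c"
proof (rule tendsto_Lim)
  show "(f \<longlongrightarrow> c) (at_left t)"
    using assms by (intro tendsto_eventually) (auto simp: eventually_at_left_field)
qed simp

lemma not_jump_time_if_constant:
  assumes "a < u" "\<And>s. a < s \<Longrightarrow> s \<le> u \<Longrightarrow> f s = c"
  shows "\<not> jump_time f u"
  using assms Lim_at_left_eqI[of a u f c] by (auto simp: jump_time_def)

text \<open>The step sits at the infimum of the times at which the path has left its initial value. Right continuity
excludes that the old value is still taken there.\<close>
lemma unit_step_time:
  fixes f :: "real \<Rightarrow> nat"
  assumes mono: "mono_on {0..} f" and rc: "\<And>t. 0 \<le> t \<Longrightarrow> continuous (at_right t) f"
    and t: "0 < t" and step: "f t = f 0 + 1"
  obtains s where "0 < s" "s \<le> t" "\<And>u. 0 \<le> u \<Longrightarrow> u < s \<Longrightarrow> f u = f 0"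
    "\<And>u. s \<le> u \<Longrightarrow> u \<le> t \<Longrightarrow> f u = f 0 + 1"
proof -
  define A where "A = {u \<in> {0..t}. f u \<noteq> f 0}"
  define s where "s = Inf A"
  have tA: "t \<in> A" using t step by (simp add: A_def)
  have bdd: "bdd_below A" by (intro bdd_belowI[of _ 0]) (auto simp: A_def)
  have st: "s \<le> t" unfolding s_def using tA bdd by (rule cInf_lower)
  have s0: "0 \<le> s" unfolding s_def using tA by (intro cInf_greatest) (auto simp: A_def)
  have before: "f u = f 0" if "0 \<le> u" "u < s" for u
    using cInf_lower[OF _ bdd, of u] that st by (fastforce simp: A_def s_def)
  have "f s \<noteq> f 0"
  proof
    assume eq: "f s = f 0"
    have "eventually (\<lambda>u. f u = f s) (at_right s)"
      using rc[OF s0] by (simp add: continuous_within tendsto_discrete)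
    then obtain b where b: "b > s" "\<And>u. s < u \<Longrightarrow> u < b \<Longrightarrow> f u = f s"
      by (auto simp: eventually_at_right_field)
    have "b \<le> Inf A"
    proof (rule cInf_greatest)
      fix u assume u: "u \<in> A"
      then have "s \<le> u" unfolding s_def using bdd by (intro cInf_lower)
      then show "b \<le> u" using b(2)[of u] eq u by (force simp: A_def)
    qed (use tA in auto)
    then show False using b(1) by (simp add: s_def)
  qed
  moreover have "f 0 \<le> f s" using mono_onD[OF mono, of 0 s] s0 by simp
  ultimately have fs: "f 0 + 1 \<le> f s" by simp
  have after: "f u = f 0 + 1" if "s \<le> u" "u \<le> t" for u
    using mono_onD[OF mono, of s u] mono_onD[OF mono, of u t] that s0 st t fs step by simp
  have "0 < s" using fs s0 by (cases "s = 0") auto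
  then show ?thesis using st before after by (rule that)
qed

lemma meteor_path_constant:
  assumes path: "meteor_path V E n m" and s: "0 \<le> s" "s \<le> t"
    and const: "\<And>v u. v \<in> V \<Longrightarrow> s \<le> u \<Longrightarrow> u \<le> t \<Longrightarrow> n v u = c v" and x: "x \<in> V"
  shows "m t x = m s x"
proof (cases "s = t")
  case False
  have "\<not> jump_time (n v) u" if "v \<in> V" "s < u" "u \<le> t" for v u
    using that const by (intro not_jump_time_if_constant[of s u _ "c v"]) auto
  moreover have "\<forall>s\<ge>0. \<forall>t>s. (\<forall>v\<in>V. \<forall>u. s < u \<and> u \<le> t \<longrightarrow> \<not> jump_time (n v) u) \<longrightarrow>
        (\<forall>x\<in>V. m t x = m s x)"
    using path unfolding meteor_path_def by (rule conjunct2)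
  ultimately show ?thesis using s x False by simp
qed simp

lemma mono_on_const:
  fixes f :: "real \<Rightarrow> nat"
  assumes "mono_on {0..} f" "f t = f 0" "0 \<le> u" "u \<le> t"
  shows "f u = f 0"
proof (rule antisym)
  show "f u \<le> f 0" using mono_onD[OF assms(1), of u t] assms(2-4) by simp
  show "f 0 \<le> f u" using mono_onD[OF assms(1), of 0 u] assms(3) by simp
qed

lemma meteor_processD:
  assumes "meteor_process \<Omega> V E N M"
  shows "prob_space \<Omega>"
    and "v \<in> V \<Longrightarrow> poisson_process \<Omega> 1 (N v)"
    and "0 \<le> t \<Longrightarrow> x \<in> V \<Longrightarrow> M t x \<in> borel_measurable \<Omega>"
    and "prob_space.indep_sets \<Omega>
       (\<lambda>i. case i of
          None \<Rightarrow> sets (vimage_algebra (space \<Omega>) (\<lambda>\<omega>. \<lambda>x\<in>V. M 0 x \<omega>) (mass_space V))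
        | Some v \<Rightarrow> sets (vimage_algebra (space \<Omega>) (\<lambda>\<omega>. \<lambda>t\<in>{0..}. N v t \<omega>) clock_space))
       (insert None (Some ` V))"
    and "AE \<omega> in \<Omega>. \<forall>x\<in>V. 0 \<le> M 0 x \<omega>"
    and "AE \<omega> in \<Omega>. meteor_path V E (\<lambda>v t. N v t \<omega>) (\<lambda>t x. M t x \<omega>)"
  using assms unfolding meteor_process_def by blast+

lemma poisson_processD:
  assumes "poisson_process \<Omega> r n"
  shows "0 \<le> t \<Longrightarrow> n t \<in> measurable \<Omega> (count_space UNIV)"
    and "AE \<omega> in \<Omega>. mono_on {0..} (\<lambda>t. n t \<omega>) \<and> (\<forall>t\<ge>0. continuous (at_right t) (\<lambda>s. n s \<omega>))"
    and "0 < t \<Longrightarrow> distr \<Omega> (count_space UNIV) (\<lambda>\<omega>. n t \<omega> - n 0 \<omega>) = measure_pmf (poisson_pmf (r * t))"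
proof -
  show "0 \<le> t \<Longrightarrow> n t \<in> measurable \<Omega> (count_space UNIV)"
    using assms unfolding poisson_process_def by blast
  have "AE \<omega> in \<Omega>. n 0 \<omega> = 0 \<and> mono_on {0..} (\<lambda>t. n t \<omega>) \<and>
        (\<forall>t\<ge>0. continuous (at_right t) (\<lambda>s. n s \<omega>))"
    using assms unfolding poisson_process_def by blast
  then show "AE \<omega> in \<Omega>. mono_on {0..} (\<lambda>t. n t \<omega>) \<and> (\<forall>t\<ge>0. continuous (at_right t) (\<lambda>s. n s \<omega>))"
    by (rule AE_mp) simp
  have "\<forall>s\<ge>0. \<forall>t>s. distr \<Omega> (count_space UNIV) (\<lambda>\<omega>. n t \<omega> - n s \<omega>)
        = measure_pmf (poisson_pmf (r * (t - s)))"
    using assms unfolding poisson_process_def by blast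
  then show "0 < t \<Longrightarrow> distr \<Omega> (count_space UNIV) (\<lambda>\<omega>. n t \<omega> - n 0 \<omega>) = measure_pmf (poisson_pmf (r * t))"
    by (metis order_refl diff_zero)
qed

context regular_graph
begin

text \<open>The masses are constant before and after the only ring, so the masses just before the ring are the initial ones and those
just after it are the final ones; where inside the interval the ring occurs does not matter.\<close>
lemma meteor_path_one_ring:
  assumes path: "meteor_path V E n m"
    and mono: "\<And>v. v \<in> V \<Longrightarrow> mono_on {0..} (n v)"
    and rc: "\<And>v t. v \<in> V \<Longrightarrow> 0 \<le> t \<Longrightarrow> continuous (at_right t) (n v)"
    and t: "0 < t" and v: "v \<in> V" and one: "n v t = n v 0 + 1"
    and none: "\<And>w. w \<in> V \<Longrightarrow> w \<noteq> v \<Longrightarrow> n w t = n w 0" and x: "x \<in> V"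
  shows "m t x = hit v (m 0) x"
proof -
  obtain s where s: "0 < s" "s \<le> t" and before: "\<And>u. 0 \<le> u \<Longrightarrow> u < s \<Longrightarrow> n v u = n v 0"
    and after: "\<And>u. s \<le> u \<Longrightarrow> u \<le> t \<Longrightarrow> n v u = n v 0 + 1"
    using unit_step_time[OF mono[OF v] rc[OF v] t one] by blast
  have others: "n w u = n w 0" if "w \<in> V" "w \<noteq> v" "0 \<le> u" "u \<le> t" for w u
    using mono_on_const[OF mono none] that by blast
  have m0: "m u y = m 0 y" if "0 \<le> u" "u < s" "y \<in> V" for u y
  proof (rule meteor_path_constant[OF path, where c = "\<lambda>w. n w 0"])
    show "n w r = n w 0" if "w \<in> V" "0 \<le> r" "r \<le> u" for w r
      using before[of r] others[of w r] that \<open>u < s\<close> s by (cases "w = v") auto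
  qed (use that in auto)
  have lim: "Lim (at_left s) (\<lambda>u. m u y) = m 0 y" if "y \<in> V" for y
    using that by (intro Lim_at_left_eqI[OF s(1)] m0) auto
  have "Lim (at_left s) (n v) = n v 0"
    by (intro Lim_at_left_eqI[OF s(1)] before) auto
  then have "jump_time (n v) s" using after[of s] s by (simp add: jump_time_def)
  then have "m s x = hit v (m 0) x"
    using path v x lim[OF x] lim[OF v] degree[OF v] unfolding meteor_path_def hit_def by auto
  moreover have "m t x = m s x"
  proof (rule meteor_path_constant[OF path, where c = "\<lambda>w. if w = v then n v 0 + 1 else n w 0"])
    show "n w r = (if w = v then n v 0 + 1 else n w 0)" if "w \<in> V" "s \<le> r" "r \<le> t" for w r
      using after[of r] others[of w r] that s by (cases "w = v") auto
  qed (use s x in auto)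
  ultimately show ?thesis by simp
qed

end

section \<open>Stationarity to first order in time\<close>

text \<open>Here \<open>exp (- K * t)\<close> and \<open>t * exp (- K * t)\<close> are the probabilities that none of \<open>K\<close> clocks rings before \<open>t\<close>,
and that a given one rings once and the others do not ring. The right-hand side is \<open>o(t)\<close>, and the
left-hand side is the absolute value of \<open>(K * F - S) * t + o(t)\<close>.\<close>
lemma first_order_coefficient:
  fixes F S B K :: real
  assumes K: "0 < K"
    and bound: "\<And>t. 0 < t \<Longrightarrow>
      \<bar>F - exp (- K * t) * F - exp (- K * t) * t * S\<bar> \<le> B * (1 - exp (- K * t) - K * (exp (- K * t) * t))"
  shows "K * F = S"
proof -
  have e: "((\<lambda>t. (1 - exp (- K * t)) / t) \<longlongrightarrow> K) (at_right 0)"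
    using K by real_asymp
  have a: "((\<lambda>t. exp (- K * t)) \<longlongrightarrow> 1) (at_right 0)"
    using K by real_asymp
  have pos: "eventually (\<lambda>t::real. 0 < t) (at_right 0)" by (simp add: eventually_at_right_less)
  have "((\<lambda>t. B * ((1 - exp (- K * t)) / t - K * exp (- K * t))) \<longlongrightarrow> B * (K - K * 1)) (at_right 0)"
    by (intro tendsto_intros e a)
  then have "((\<lambda>t. B * ((1 - exp (- K * t)) / t - K * exp (- K * t))) \<longlongrightarrow> 0) (at_right 0)"
    by simp
  moreover have "eventually (\<lambda>t. norm (F * ((1 - exp (- K * t)) / t) - exp (- K * t) * S)
      \<le> B * ((1 - exp (- K * t)) / t - K * exp (- K * t))) (at_right 0)"
    using pos
  proof eventually_elim
    case (elim t)
    have "F * ((1 - exp (- K * t)) / t) - exp (- K * t) * S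
        = (F - exp (- K * t) * F - exp (- K * t) * t * S) / t"
      using elim by (simp add: field_simps)
    then have "norm (F * ((1 - exp (- K * t)) / t) - exp (- K * t) * S)
        = \<bar>F - exp (- K * t) * F - exp (- K * t) * t * S\<bar> / t"
      using elim by (simp add: abs_divide)
    also have "\<dots> \<le> B * (1 - exp (- K * t) - K * (exp (- K * t) * t)) / t"
      using bound[OF elim] elim by (intro divide_right_mono) auto
    also have "\<dots> = B * ((1 - exp (- K * t)) / t - K * exp (- K * t))"
      using elim by (simp add: field_simps)
    finally show ?case .
  qed
  ultimately have "((\<lambda>t. F * ((1 - exp (- K * t)) / t) - exp (- K * t) * S) \<longlongrightarrow> 0) (at_right 0)"
    by (rule Lim_null_comparison[rotated])
  moreover have "((\<lambda>t. F * ((1 - exp (- K * t)) / t) - exp (- K * t) * S) \<longlongrightarrow> F * K - 1 * S) (at_right 0)"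
    by (intro tendsto_intros e a)
  ultimately have "F * K - 1 * S = 0"
    by (rule tendsto_unique[OF trivial_limit_at_right_real, rotated])
  then show ?thesis by (simp add: mult.commute)
qed

context regular_graph
begin

text \<open>The independence of the initial masses from the clocks, in the form needed here: a function of the initial masses is
uncorrelated with the event that each clock \<open>v\<close> rings exactly \<open>c v\<close> times before \<open>t\<close>.\<close>
lemma meteor_clock_independence:
  assumes mp: "meteor_process \<Omega> V E N M" and t: "0 < t"
    and g: "g \<in> borel_measurable (mass_space V)" and bnd: "\<And>m. \<bar>g m\<bar> \<le> B"
  shows "(\<integral>\<omega>. g (\<lambda>x\<in>V. M 0 x \<omega>) * (\<Prod>v\<in>V. of_bool (N v t \<omega> - N v 0 \<omega> = c v)) \<partial>\<Omega>)
      = (\<integral>\<omega>. g (\<lambda>x\<in>V. M 0 x \<omega>) \<partial>\<Omega>) * (\<Prod>v\<in>V. pmf (poisson_pmf t) (c v))"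
proof -
  interpret prob_space \<Omega> using mp by (rule meteor_processD)
  let ?X0 = "\<lambda>\<omega>. \<lambda>x\<in>V. M 0 x \<omega>"
  define A where "A v \<omega> = (of_bool (N v t \<omega> - N v 0 \<omega> = c v) :: real)" for v \<omega>
  define X where "X i = (case i of None \<Rightarrow> (\<lambda>\<omega>. g (?X0 \<omega>)) | Some v \<Rightarrow> A v)" for i
  let ?F = "\<lambda>i. case i of
          None \<Rightarrow> vimage_algebra (space \<Omega>) ?X0 (mass_space V)
        | Some v \<Rightarrow> vimage_algebra (space \<Omega>) (\<lambda>\<omega>. \<lambda>t\<in>{0..}. N v t \<omega>) clock_space"
  let ?I = "insert None (Some ` V)"
  have X0: "?X0 \<in> measurable \<Omega> (mass_space V)"
    using meteor_processD(3)[OF mp] by (intro measurable_restrict) auto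
  have N: "N v s \<in> measurable \<Omega> (count_space UNIV)" if "v \<in> V" "0 \<le> s" for v s
    using meteor_processD(2)[OF mp that(1)] that(2) by (rule poisson_processD)
  have spF: "space (?F i) = space \<Omega>" for i by (cases i) auto
  have XF: "X i \<in> borel_measurable (?F i)" if "i \<in> ?I" for i
  proof (cases i)
    case None
    have "(\<lambda>\<omega>. g (?X0 \<omega>)) \<in> borel_measurable (vimage_algebra (space \<Omega>) ?X0 (mass_space V))"
      using g by (rule measurable_compose[rotated])
        (intro measurable_vimage_algebra1, auto simp: space_PiM)
    then show ?thesis using None by (simp add: X_def)
  next
    case (Some v)
    let ?K = "vimage_algebra (space \<Omega>) (\<lambda>\<omega>. \<lambda>t\<in>{0..}. N v t \<omega>) clock_space"
    have K: "(\<lambda>\<omega>. \<lambda>t\<in>{0..}. N v t \<omega>) \<in> measurable ?K clock_space"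
      by (intro measurable_vimage_algebra1) (auto simp: space_PiM)
    have "(\<lambda>\<omega>. (\<lambda>t\<in>{0..}. N v t \<omega>) s) \<in> measurable ?K (count_space UNIV)" if "0 \<le> s" for s
      by (rule measurable_compose[OF K measurable_component_singleton]) (use that in simp)
    then have "N v s \<in> measurable ?K (count_space UNIV)" if "0 \<le> s" for s
      using that by simp
    then have [measurable]: "N v t \<in> measurable ?K (count_space UNIV)" "N v 0 \<in> measurable ?K (count_space UNIV)"
      using t by auto
    have "A v \<in> borel_measurable ?K"
      unfolding A_def by measurable
    then show ?thesis using Some by (simp add: X_def)
  qed
  have X\<Omega>: "X i \<in> borel_measurable \<Omega>" if "i \<in> ?I" for i
  proof (cases i)
    case None
    then show ?thesis using X0 g by (simp add: X_def)
  next
    case (Some v)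
    then have "v \<in> V" using that by auto
    then have [measurable]: "N v t \<in> measurable \<Omega> (count_space UNIV)" "N v 0 \<in> measurable \<Omega> (count_space UNIV)"
      using N t by auto
    have "A v \<in> borel_measurable \<Omega>" unfolding A_def by measurable
    then show ?thesis using Some by (simp add: X_def)
  qed
  have "indep_sets (\<lambda>i. sets (?F i)) ?I"
    using meteor_processD(4)[OF mp] by (simp add: option.case_distrib cong: option.case_cong)
  then have "indep_sets (\<lambda>i. {X i -` A \<inter> space \<Omega> |A. A \<in> sets borel}) ?I"
  proof (rule indep_sets_mono_sets)
    fix i assume "i \<in> ?I"
    then show "{X i -` A \<inter> space \<Omega> |A. A \<in> sets borel} \<subseteq> sets (?F i)"
      using measurable_sets[OF XF, of i] spF[of i] by auto
  qed
  then have indep: "indep_vars (\<lambda>_. borel) X ?I"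
    using X\<Omega> by (simp add: indep_vars_def2)
  have int: "integrable \<Omega> (X i)" if "i \<in> ?I" for i
    using bnd by (intro integrable_const_bound[where B = "max B 1"] X\<Omega>[OF that])
      (auto simp: X_def A_def le_max_iff_disj split: option.splits)
  have "(\<integral>\<omega>. (\<Prod>i\<in>?I. X i \<omega>) \<partial>\<Omega>) = (\<Prod>i\<in>?I. \<integral>\<omega>. X i \<omega> \<partial>\<Omega>)"
    using finite_V indep int by (intro indep_vars_lebesgue_integral) auto
  moreover have "(\<integral>\<omega>. A v \<omega> \<partial>\<Omega>) = pmf (poisson_pmf t) (c v)" if v: "v \<in> V" for v
  proof -
    let ?D = "\<lambda>\<omega>. N v t \<omega> - N v 0 \<omega>"
    have "distr \<Omega> (count_space UNIV) ?D = measure_pmf (poisson_pmf t)"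
      using poisson_processD(3)[OF meteor_processD(2)[OF mp v] t] by simp
    moreover have [measurable]: "N v t \<in> measurable \<Omega> (count_space UNIV)" "N v 0 \<in> measurable \<Omega> (count_space UNIV)"
      using N v t by auto
    have D: "?D \<in> measurable \<Omega> (count_space UNIV)" by measurable
    have "(\<integral>\<omega>. A v \<omega> \<partial>\<Omega>) = (\<integral>j. of_bool (j = c v) \<partial>distr \<Omega> (count_space UNIV) ?D)"
      using D by (simp add: A_def integral_distr)
    ultimately have "(\<integral>\<omega>. A v \<omega> \<partial>\<Omega>) = (\<integral>j. indicator {c v} j \<partial>measure_pmf (poisson_pmf t))"
      by (simp add: indicator_def of_bool_def)
    then show ?thesis by (simp add: measure_pmf_single)
  qed
  ultimately show ?thesis
    using finite_V by (simp add: prod.reindex X_def A_def[symmetric])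
qed

lemma measurable_hit:
  "v \<in> V \<Longrightarrow> (\<lambda>m. \<lambda>x\<in>V. hit v m x) \<in> measurable (mass_space V) (mass_space V)"
  unfolding hit_def by (intro measurable_restrict) measurable

text \<open>The expectation of \<open>f\<close> at time \<open>t\<close> is split according to whether no clock has rung, exactly one clock
has rung exactly once, or anything else has happened. On the first event the masses are the initial ones, on the second
they are the initial ones after one hit, and the clocks are independent of the initial masses.
Boundedness of \<open>f\<close> controls the third, whose probability is \<open>o(t)\<close>.\<close>
lemma stationary_hit_identity:
  assumes st: "stationary_meteor_process \<Omega> V E N M k Q"
    and f: "f \<in> borel_measurable (mass_space V)" and bnd: "\<And>m. \<bar>f m\<bar> \<le> B"
  shows "real (card V) * (\<integral>m. f m \<partial>Q) = (\<Sum>v\<in>V. \<integral>m. f (\<lambda>x\<in>V. hit v m x) \<partial>Q)"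
proof (cases "V = {}")
  case False
  have mp: "meteor_process \<Omega> V E N M" using st unfolding stationary_meteor_process_def by blast
  interpret prob_space \<Omega> using mp by (rule meteor_processD)
  define X where "X t \<omega> = (\<lambda>x\<in>V. M t x \<omega>)" for t \<omega>
  define fh where "fh v m = f (\<lambda>x\<in>V. hit v m x)" for v m
  \<comment> \<open>The indicator of the event that every clock \<open>v\<close> rings \<open>c v\<close> times up to time \<open>t\<close>.\<close>
  define R where "R c t \<omega> = (\<Prod>v\<in>V. of_bool (N v t \<omega> - N v 0 \<omega> = c v) :: real)" for c t \<omega>
  define only where "only v w = (if w = v then 1 else 0 :: nat)" for v w :: 'v
  have Q: "Q = distr \<Omega> (mass_space V) (X t)" if "0 \<le> t" for t
    using st that unfolding stationary_meteor_process_def X_def by blast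
  have X: "X t \<in> measurable \<Omega> (mass_space V)" if "0 \<le> t" for t
    unfolding X_def using meteor_processD(3)[OF mp that] by (intro measurable_restrict) auto
  have N: "N v s \<in> measurable \<Omega> (count_space UNIV)" if "v \<in> V" "0 \<le> s" for v s
    using meteor_processD(2)[OF mp that(1)] that(2) by (rule poisson_processD)
  have EX: "(\<integral>\<omega>. g (X t \<omega>) \<partial>\<Omega>) = (\<integral>m. g m \<partial>Q)"
    if "0 \<le> t" "g \<in> borel_measurable (mass_space V)" for g :: "_ \<Rightarrow> real" and t
    using Q[OF that(1)] X[OF that(1)] that(2) by (simp add: integral_distr)
  have fh: "fh v \<in> borel_measurable (mass_space V)" if "v \<in> V" for v
    unfolding fh_def using measurable_compose[OF measurable_hit[OF that] f] by simp
  have R_eq: "R c t \<omega> = of_bool (\<forall>v\<in>V. N v t \<omega> - N v 0 \<omega> = c v)" for c t \<omega>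
    unfolding R_def using finite_V by (induction rule: finite_induct) auto
  have R: "R c t \<in> borel_measurable \<Omega>" if "0 \<le> t" for c t
  proof -
    have "(\<lambda>\<omega>. of_bool (N v t \<omega> - N v 0 \<omega> = c v) :: real) \<in> borel_measurable \<Omega>" if "v \<in> V" for v
    proof -
      have [measurable]: "N v t \<in> measurable \<Omega> (count_space UNIV)" "N v 0 \<in> measurable \<Omega> (count_space UNIV)"
        using N[OF that] \<open>0 \<le> t\<close> by auto
      show ?thesis by measurable
    qed
    then show ?thesis unfolding R_def by (intro borel_measurable_prod)
  qed
  have int: "integrable \<Omega> (\<lambda>\<omega>. g (X s \<omega>) * R c t \<omega>)"
    if "g \<in> borel_measurable (mass_space V)" "\<And>m. \<bar>g m\<bar> \<le> b" "0 \<le> s" "0 \<le> t"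
    for g :: "_ \<Rightarrow> real" and b s t c
  proof (rule integrable_const_bound[where B = b])
    have "0 \<le> b" using that(2) abs_ge_zero order_trans by blast
    then show "AE \<omega> in \<Omega>. norm (g (X s \<omega>) * R c t \<omega>) \<le> b"
      using that(2) by (simp add: R_eq)
    show "(\<lambda>\<omega>. g (X s \<omega>) * R c t \<omega>) \<in> borel_measurable \<Omega>"
      using measurable_compose[OF X[OF that(3)] that(1)] R[OF that(4)] by simp
  qed
  have indep: "(\<integral>\<omega>. g (X 0 \<omega>) * R c t \<omega> \<partial>\<Omega>) = (\<integral>m. g m \<partial>Q) * (\<Prod>v\<in>V. pmf (poisson_pmf t) (c v))"
    if "g \<in> borel_measurable (mass_space V)" "\<And>m. \<bar>g m\<bar> \<le> b" "0 < t"
    for g :: "_ \<Rightarrow> real" and b t c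
    using meteor_clock_independence[OF mp that(3,1,2), of c] EX[OF order_refl that(1)]
    by (simp add: X_def R_def)
  define a where "a t = exp (- real (card V) * t)" for t
  have p0: "(\<Prod>v\<in>V. pmf (poisson_pmf t) 0) = a t" if "0 < t" for t
    using that by (simp add: a_def exp_of_nat_mult[symmetric])
  have p1: "(\<Prod>w\<in>V. pmf (poisson_pmf t) (only v w)) = t * a t" if "0 < t" "v \<in> V" for t v
  proof -
    have "(\<Prod>w\<in>V. pmf (poisson_pmf t) (only v w)) = (\<Prod>w\<in>V. (if w = v then t else 1) * exp (- t))"
      using that by (intro prod.cong) (auto simp: only_def)
    then show ?thesis
      using that finite_V by (simp add: prod.distrib a_def exp_of_nat_mult[symmetric])
  qed
  have paths: "AE \<omega> in \<Omega>. meteor_path V E (\<lambda>v t. N v t \<omega>) (\<lambda>t x. M t x \<omega>)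
      \<and> (\<forall>v\<in>V. mono_on {0..} (\<lambda>t. N v t \<omega>) \<and> (\<forall>t\<ge>0. continuous (at_right t) (\<lambda>s. N v s \<omega>)))"
  proof -
    have "AE \<omega> in \<Omega>. \<forall>v\<in>V. mono_on {0..} (\<lambda>t. N v t \<omega>) \<and> (\<forall>t\<ge>0. continuous (at_right t) (\<lambda>s. N v s \<omega>))"
      using finite_V by (intro AE_finite_allI poisson_processD(2)[OF meteor_processD(2)[OF mp]])
    with meteor_processD(6)[OF mp] show ?thesis by (rule AE_conjI)
  qed
  have "real (card V) * (\<integral>m. f m \<partial>Q) = (\<Sum>v\<in>V. \<integral>m. fh v m \<partial>Q)"
  proof (rule first_order_coefficient[where B = B])
    show "0 < real (card V)" using False finite_V by (simp add: card_gt_0_iff)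
    fix t :: real
    assume t: "0 < t"
    have AE0: "AE \<omega> in \<Omega>. f (X t \<omega>) * R (\<lambda>_. 0) t \<omega> = f (X 0 \<omega>) * R (\<lambda>_. 0) t \<omega>"
      using paths
    proof eventually_elim
      case (elim \<omega>)
      show ?case
      proof (cases "\<forall>v\<in>V. N v t \<omega> - N v 0 \<omega> = 0")
        case True
        have eq: "N v t \<omega> = N v 0 \<omega>" if "v \<in> V" for v
          using True that elim t mono_onD[of "{0..}" "\<lambda>t. N v t \<omega>" 0 t] by force
        have "M t x \<omega> = M 0 x \<omega>" if "x \<in> V" for x
        proof (rule meteor_path_constant[of V E "\<lambda>v t. N v t \<omega>" "\<lambda>t x. M t x \<omega>"])
          show "N v u \<omega> = N v 0 \<omega>" if "v \<in> V" "0 \<le> u" "u \<le> t" for v u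
            by (rule mono_on_const[of "\<lambda>t. N v t \<omega>" t]) (use elim eq[OF that(1)] that in auto)
        qed (use elim t that in auto)
        then have "X t \<omega> = X 0 \<omega>" unfolding X_def by (rule restrict_ext)
        then show ?thesis by simp
      qed (simp add: R_eq)
    qed
    have AE1: "AE \<omega> in \<Omega>. f (X t \<omega>) * R (only v) t \<omega> = fh v (X 0 \<omega>) * R (only v) t \<omega>"
      if v: "v \<in> V" for v
      using paths
    proof eventually_elim
      case (elim \<omega>)
      show ?case
      proof (cases "\<forall>w\<in>V. N w t \<omega> - N w 0 \<omega> = only v w")
        case True
        have le: "N w 0 \<omega> \<le> N w t \<omega>" if "w \<in> V" for w
          using that elim t mono_onD[of "{0..}" "\<lambda>t. N w t \<omega>" 0 t] by force
        have "M t x \<omega> = hit v (\<lambda>x. M 0 x \<omega>) x" if x: "x \<in> V" for x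
        proof (rule meteor_path_one_ring[of "\<lambda>v t. N v t \<omega>" "\<lambda>t x. M t x \<omega>", OF _ _ _ t v _ _ x])
          show "N v t \<omega> = N v 0 \<omega> + 1" using True v le[OF v] by (force simp: only_def)
          show "N w t \<omega> = N w 0 \<omega>" if "w \<in> V" "w \<noteq> v" for w
            using True that le[OF that(1)] by (force simp: only_def)
        qed (use elim in auto)
        then have "X t \<omega> = (\<lambda>x\<in>V. hit v (X 0 \<omega>) x)"
          using v by (auto simp: X_def hit_def intro!: restrict_ext)
        then show ?thesis by (simp add: fh_def)
      qed (simp add: R_eq)
    qed
    \<comment> \<open>The indicator of the event that the clocks ring at least twice in total.\<close>
    define rest where "rest \<omega> = 1 - R (\<lambda>_. 0) t \<omega> - (\<Sum>v\<in>V. R (only v) t \<omega>)" for \<omega>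
    have rest_nonneg: "0 \<le> rest \<omega>" for \<omega>
    proof (cases "\<exists>v\<in>V. \<forall>w\<in>V. N w t \<omega> - N w 0 \<omega> = only v w")
      case True
      then obtain v where v: "v \<in> V" "\<forall>w\<in>V. N w t \<omega> - N w 0 \<omega> = only v w" by blast
      have "R (only u) t \<omega> = of_bool (u = v)" if "u \<in> V" for u
        using v that by (auto simp: R_eq only_def)
      then have "(\<Sum>u\<in>V. R (only u) t \<omega>) = 1" using v finite_V by simp
      moreover have "R (\<lambda>_. 0) t \<omega> = 0" using v by (auto simp: R_eq only_def)
      ultimately show ?thesis by (simp add: rest_def)
    next
      case False
      then have "(\<Sum>u\<in>V. R (only u) t \<omega>) = 0" by (intro sum.neutral) (auto simp: R_eq)
      then show ?thesis by (simp add: rest_def R_eq)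
    qed
    note t' = less_imp_le[OF t]
    have fint: "integrable \<Omega> (\<lambda>\<omega>. f (X t \<omega>) * R c t \<omega>)" for c
      by (rule int[OF f bnd t' t'])
    have Rint: "integrable \<Omega> (R c t)" for c
      using int[of "\<lambda>_. 1" 1 t t c] t' by simp
    have f1: "integrable \<Omega> (\<lambda>\<omega>. f (X t \<omega>))"
      using measurable_compose[OF X[OF t'] f] bnd by (intro integrable_const_bound[where B = B]) auto
    have E0: "(\<integral>\<omega>. f (X t \<omega>) * R (\<lambda>_. 0) t \<omega> \<partial>\<Omega>) = (\<integral>m. f m \<partial>Q) * a t"
    proof -
      have "(\<integral>\<omega>. f (X t \<omega>) * R (\<lambda>_. 0) t \<omega> \<partial>\<Omega>) = (\<integral>\<omega>. f (X 0 \<omega>) * R (\<lambda>_. 0) t \<omega> \<partial>\<Omega>)"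
        using fint int[OF f bnd order_refl t'] by (intro integral_cong_AE AE0) auto
      then show ?thesis using indep[OF f bnd t, of "\<lambda>_. 0"] p0[OF t] by simp
    qed
    have E1: "(\<integral>\<omega>. f (X t \<omega>) * R (only v) t \<omega> \<partial>\<Omega>) = (\<integral>m. fh v m \<partial>Q) * (t * a t)"
      if v: "v \<in> V" for v
    proof -
      have fb: "\<bar>fh v m\<bar> \<le> B" for m by (simp add: fh_def bnd)
      have "(\<integral>\<omega>. f (X t \<omega>) * R (only v) t \<omega> \<partial>\<Omega>) = (\<integral>\<omega>. fh v (X 0 \<omega>) * R (only v) t \<omega> \<partial>\<Omega>)"
        using fint int[OF fh[OF v] fb order_refl t'] by (intro integral_cong_AE AE1 v) auto
      then show ?thesis using indep[OF fh[OF v] fb t, of "only v"] p1[OF t v] by simp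
    qed
    have f_rest: "f (X t \<omega>) * rest \<omega>
        = f (X t \<omega>) - f (X t \<omega>) * R (\<lambda>_. 0) t \<omega> - (\<Sum>v\<in>V. f (X t \<omega>) * R (only v) t \<omega>)" for \<omega>
      by (simp add: rest_def right_diff_distrib sum_distrib_left)
    have intf: "integrable \<Omega> (\<lambda>\<omega>. f (X t \<omega>) * rest \<omega>)"
      unfolding f_rest using f1 fint by simp
    have "(\<integral>\<omega>. f (X t \<omega>) * rest \<omega> \<partial>\<Omega>)
        = (\<integral>m. f m \<partial>Q) - (\<integral>m. f m \<partial>Q) * a t - (\<Sum>v\<in>V. (\<integral>m. fh v m \<partial>Q) * (t * a t))"
      unfolding f_rest using f1 fint E0 E1 EX[OF t' f] by simp
    then have Ef: "(\<integral>\<omega>. f (X t \<omega>) * rest \<omega> \<partial>\<Omega>)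
        = (\<integral>m. f m \<partial>Q) - a t * (\<integral>m. f m \<partial>Q) - a t * t * (\<Sum>v\<in>V. \<integral>m. fh v m \<partial>Q)"
      by (simp add: sum_distrib_left mult_ac)
    have P0: "(\<integral>\<omega>. R (\<lambda>_. 0) t \<omega> \<partial>\<Omega>) = a t"
      using indep[of "\<lambda>_. 1" 1 t "\<lambda>_. 0"] t p0[OF t] EX[of 0 "\<lambda>_. 1"] by (simp add: prob_space)
    have P1: "(\<integral>\<omega>. R (only v) t \<omega> \<partial>\<Omega>) = t * a t" if "v \<in> V" for v
      using indep[of "\<lambda>_. 1" 1 t "only v"] t p1[OF t that] EX[of 0 "\<lambda>_. 1"] by (simp add: prob_space)
    have Er: "(\<integral>\<omega>. rest \<omega> \<partial>\<Omega>) = 1 - a t - real (card V) * (a t * t)" and intr: "integrable \<Omega> rest"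
      using Rint P0 P1 unfolding rest_def[abs_def] by (simp_all add: prob_space mult_ac)
    have "\<bar>\<integral>\<omega>. f (X t \<omega>) * rest \<omega> \<partial>\<Omega>\<bar> \<le> (\<integral>\<omega>. \<bar>f (X t \<omega>) * rest \<omega>\<bar> \<partial>\<Omega>)"
      by (rule integral_abs_bound)
    also have "\<dots> \<le> (\<integral>\<omega>. B * rest \<omega> \<partial>\<Omega>)"
      using intr bnd rest_nonneg
      by (intro integral_mono[OF integrable_abs[OF intf]]) (auto simp: abs_mult mult_right_mono)
    also have "\<dots> = B * (1 - a t - real (card V) * (a t * t))" using Er by simp
    finally show "\<bar>(\<integral>m. f m \<partial>Q) - exp (- real (card V) * t) * (\<integral>m. f m \<partial>Q)
        - exp (- real (card V) * t) * t * (\<Sum>v\<in>V. \<integral>m. fh v m \<partial>Q)\<bar>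
      \<le> B * (1 - exp (- real (card V) * t) - real (card V) * (exp (- real (card V) * t) * t))"
      unfolding Ef a_def .
  qed
  then show ?thesis by (simp add: fh_def)
qed simp

section \<open>Moments of the stationary law on a regular graph\<close>

text \<open>Almost surely the masses are nonnegative with sum \<open>card V\<close>, hence at most \<open>card V\<close>, and a hit preserves these bounds. This allows
the product \<open>m x * m y\<close> to be replaced by the bounded function that \<open>stationary_hit_identity\<close>
asks for.\<close>
lemma stationary_moments:
  assumes st: "stationary_meteor_process \<Omega> V E N M (real (card V)) Q"
  shows stationary_prob_space: "prob_space Q"
    and integrable_mass: "\<And>x. x \<in> V \<Longrightarrow> integrable Q (\<lambda>m. m x)"
    and integrable_mass_prod: "\<And>x y. x \<in> V \<Longrightarrow> y \<in> V \<Longrightarrow> integrable Q (\<lambda>m. m x * m y)"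
    and second_moment: "\<And>x y. x \<in> V \<Longrightarrow> y \<in> V \<Longrightarrow> (\<integral>m. m x * m y \<partial>Q) = pair_moment x y"
    and mean_mass: "\<And>x. x \<in> V \<Longrightarrow> (\<integral>m. m x \<partial>Q) = 1"
proof -
  let ?k = "real (card V)"
  have mp: "meteor_process \<Omega> V E N M" using st unfolding stationary_meteor_process_def by blast
  interpret O: prob_space \<Omega> using mp by (rule meteor_processD)
  let ?X = "\<lambda>\<omega>. \<lambda>x\<in>V. M 0 x \<omega>"
  have X: "?X \<in> measurable \<Omega> (mass_space V)"
    using meteor_processD(3)[OF mp, of 0] by (intro measurable_restrict) auto
  have Q: "Q = distr \<Omega> (mass_space V) ?X"
    using st unfolding stationary_meteor_process_def by blast
  show "prob_space Q" unfolding Q by (rule O.prob_space_distr[OF X])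
  interpret prob_space Q by fact
  have setsQ [measurable_cong]: "sets Q = sets (mass_space V)" by (simp add: Q)
  have mass [measurable]: "(\<lambda>m. m x) \<in> borel_measurable Q" if "x \<in> V" for x
    using that by measurable
  define admissible where "admissible m \<longleftrightarrow> (\<forall>x\<in>V. 0 \<le> m x) \<and> (\<Sum>x\<in>V. m x) = ?k" for m :: "'v \<Rightarrow> real"
  have total_mass: "AE \<omega> in \<Omega>. (\<Sum>x\<in>V. M 0 x \<omega>) = ?k"
    using st unfolding stationary_meteor_process_def by blast
  have initial: "AE \<omega> in \<Omega>. admissible (?X \<omega>)"
    using meteor_processD(5)[OF mp] total_mass
  proof eventually_elim
    case (elim \<omega>)
    then show ?case unfolding admissible_def by simp
  qed
  have admissible_sets: "{m \<in> space (mass_space V). admissible m} \<in> sets (mass_space V)"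
    unfolding admissible_def using finite_V by measurable
  have admissible: "AE m in Q. admissible m"
    unfolding Q AE_distr_iff[OF X admissible_sets] by (rule initial)
  have pair_le: "m x + m v \<le> ?k" if "admissible m" "x \<in> V" "v \<in> V" "x \<noteq> v" for m x v
    using sum_mono2[of V "{x, v}" m] that finite_V by (auto simp: admissible_def)
  have le: "m x \<le> ?k" if "admissible m" "x \<in> V" for m x
    using member_le_sum[of x V m] that finite_V by (auto simp: admissible_def)
  have hit_range: "0 \<le> hit v m x \<and> hit v m x \<le> ?k" if "admissible m" "x \<in> V" "v \<in> V" for m x v
  proof (cases "x = v")
    case False
    have nonneg: "0 \<le> m x" "0 \<le> m v" using that by (auto simp: admissible_def)
    then have "m v / real D \<le> m v" using D_pos by (simp add: divide_le_eq mult_le_cancel_left1)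
    then show ?thesis
      using False nonneg pair_le[OF that False] le[OF that(1,2)] by (auto simp: hit_def)
  qed (simp add: hit_def)
  show int1: "integrable Q (\<lambda>m. m x)" if "x \<in> V" for x
  proof (rule integrable_const_bound[where B = ?k])
    show "AE m in Q. norm (m x) \<le> ?k"
      using admissible
    proof eventually_elim
      case (elim m)
      then show ?case using le[OF elim that] that by (simp add: admissible_def)
    qed
  qed (use that in measurable)
  show int2: "integrable Q (\<lambda>m. m x * m y)" if "x \<in> V" "y \<in> V" for x y
  proof (rule integrable_const_bound[where B = "?k * ?k"])
    show "AE m in Q. norm (m x * m y) \<le> ?k * ?k"
      using admissible
    proof eventually_elim
      case (elim m)
      then show ?case using le[OF elim] that
        by (auto simp: admissible_def abs_mult intro!: mult_mono)
    qed
  qed (use that in measurable)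
  define K where "K x y = (\<integral>m. m x * m y \<partial>Q)" for x y
  \<comment> \<open>Truncation to the interval that contains all masses before and after a hit.\<close>
  define clip where "clip a = max 0 (min ?k a)" for a
  have clip_id: "clip a = a" if "0 \<le> a" "a \<le> ?k" for a using that by (simp add: clip_def)
  have K_inv: "?k * K x y = (\<Sum>v\<in>V. \<Sum>u\<in>V. \<Sum>w\<in>V. K u w * (jump_prob v u x * jump_prob v w y))"
    if xy: "x \<in> V" "y \<in> V" for x y
  proof -
    define f where "f m = clip (m x) * clip (m y)" for m :: "'v \<Rightarrow> real"
    have f: "f \<in> borel_measurable (mass_space V)"
      unfolding f_def clip_def using xy by measurable
    have fb: "\<bar>f m\<bar> \<le> ?k * ?k" for m
      unfolding f_def abs_mult by (intro mult_mono) (auto simp: clip_def)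
    have fm: "(\<integral>m. f m \<partial>Q) = K x y"
      unfolding K_def
    proof (rule integral_cong_AE)
      show "AE m in Q. f m = m x * m y"
        using admissible
      proof eventually_elim
        case (elim m)
        then show ?case using le[OF elim] xy by (simp add: f_def clip_id admissible_def)
      qed
    qed (use f xy in \<open>auto simp: measurable_cong_sets[OF setsQ refl]\<close>)
    have fh: "(\<integral>m. f (\<lambda>x\<in>V. hit v m x) \<partial>Q)
        = (\<Sum>u\<in>V. \<Sum>w\<in>V. K u w * (jump_prob v u x * jump_prob v w y))" if v: "v \<in> V" for v
    proof -
      have prod_eq: "hit v m x * hit v m y
          = (\<Sum>u\<in>V. \<Sum>w\<in>V. m u * m w * (jump_prob v u x * jump_prob v w y))" for m
        using v xy by (simp add: hit_eq_sum sum_product mult_ac)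
      have "(\<integral>m. f (\<lambda>x\<in>V. hit v m x) \<partial>Q) = (\<integral>m. hit v m x * hit v m y \<partial>Q)"
      proof (rule integral_cong_AE)
        show "AE m in Q. f (\<lambda>x\<in>V. hit v m x) = hit v m x * hit v m y"
          using admissible
        proof eventually_elim
          case (elim m)
          then show ?case using hit_range[OF elim] v xy by (simp add: f_def clip_id)
        qed
        show "(\<lambda>m. f (\<lambda>x\<in>V. hit v m x)) \<in> borel_measurable Q"
          using measurable_compose[OF measurable_hit[OF v] f] by (simp add: measurable_cong_sets[OF setsQ refl])
      qed (use v xy in \<open>unfold hit_def, measurable\<close>)
      also have "\<dots> = (\<Sum>u\<in>V. \<Sum>w\<in>V. K u w * (jump_prob v u x * jump_prob v w y))"
        unfolding prod_eq K_def using int2 by simp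
      finally show ?thesis .
    qed
    show ?thesis
      using stationary_hit_identity[OF st f fb] fm fh by simp
  qed
  have "(\<Sum>x\<in>V. \<Sum>y\<in>V. K x y) = (\<integral>m. (\<Sum>x\<in>V. m x) * (\<Sum>y\<in>V. m y) \<partial>Q)"
    unfolding K_def sum_product using int2 by simp
  also have "\<dots> = (\<integral>m. ?k * ?k \<partial>Q)"
  proof (rule integral_cong_AE)
    show "AE m in Q. (\<Sum>x\<in>V. m x) * (\<Sum>y\<in>V. m y) = ?k * ?k"
      using admissible by eventually_elim (simp add: admissible_def)
  qed measurable
  finally have total: "(\<Sum>x\<in>V. \<Sum>y\<in>V. K x y) = ?k\<^sup>2"
    by (simp add: prob_space power2_eq_square)
  show moment: "(\<integral>m. m x * m y \<partial>Q) = pair_moment x y" if "x \<in> V" "y \<in> V" for x y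
    using pair_moment_unique[of K, OF K_inv total that] by (simp add: K_def)
  show "(\<integral>m. m y \<partial>Q) = 1" if y: "y \<in> V" for y
  proof -
    have "?k * (\<integral>m. m y \<partial>Q) = (\<integral>m. ?k * m y \<partial>Q)" by simp
    also have "\<dots> = (\<integral>m. (\<Sum>x\<in>V. m x * m y) \<partial>Q)"
    proof (rule integral_cong_AE)
      show "AE m in Q. ?k * m y = (\<Sum>x\<in>V. m x * m y)"
        using admissible by eventually_elim (simp add: admissible_def sum_distrib_right[symmetric])
    qed (use y in measurable)
    also have "\<dots> = (\<Sum>x\<in>V. pair_moment x y)" using int2 y moment by simp
    also have "\<dots> = ?k" by (rule sum_pair_moment[OF y])
    finally show ?thesis using y finite_V by auto
  qed
qed

lemma stationary_covariance:
  assumes st: "stationary_meteor_process \<Omega> V E N M (real (card V)) Q" and xy: "x \<in> V" "y \<in> V"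
  shows "covariance Q (\<lambda>m. m x) (\<lambda>m. m y) = of_bool (x = y) - of_bool (E x y) / real D"
proof -
  interpret prob_space Q by (rule stationary_prob_space[OF st])
  have "covariance Q (\<lambda>m. m x) (\<lambda>m. m y) = (\<integral>m. m x * m y - m x - m y + 1 \<partial>Q)"
    using xy by (simp add: covariance_def mean_mass[OF st] algebra_simps)
  also have "\<dots> = pair_moment x y - 1"
    using xy integrable_mass[OF st] integrable_mass_prod[OF st] by (simp add: second_moment[OF st] mean_mass[OF st] prob_space)
  finally show ?thesis by (simp add: pair_moment_def)
qed

end

section \<open>The discrete torus\<close>

lemma card_torus: "card (torus n :: (int ^ 'd::finite) set) = n ^ CARD('d)"
proof -
  have "bij_betw (\<lambda>f. \<chi> i. f i) (PiE UNIV (\<lambda>_::'d. {0..<int n})) (torus n)"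
    by (rule bij_betwI[where g = "\<lambda>x i. x $ i"]) (auto simp: torus_def)
  then have "card (torus n :: (int ^ 'd) set) = card (PiE UNIV (\<lambda>_::'d. {0..<int n}))"
    by (rule bij_betw_same_card[symmetric])
  then show ?thesis by (simp add: card_PiE)
qed

text \<open>For residues in range the two neighbours can be written without \<open>mod\<close>, which leaves only linear arithmetic.\<close>
lemma cycle_adj_iff:
  assumes "2 \<le> n" "0 \<le> a" "a < int n" "0 \<le> b" "b < int n"
  shows "cycle_adj n a b \<longleftrightarrow>
    b = (if a + 1 = int n then 0 else a + 1) \<or> b = (if a = 0 then int n - 1 else a - 1)"
proof -
  have succ: "(c + 1) mod int n = (if c + 1 = int n then 0 else c + 1)" if "0 \<le> c" "c < int n" for c
    using that by auto
  show ?thesis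
    using assms unfolding cycle_adj_def succ[OF assms(2,3)] succ[OF assms(4,5)] by auto
qed

text \<open>The cycle of length two has a single edge, since the successor and the predecessor coincide.\<close>
lemma card_cycle_neighbours:
  assumes "2 \<le> n" "0 \<le> a" "a < int n"
  shows "card {b. 0 \<le> b \<and> b < int n \<and> cycle_adj n a b} = (if n = 2 then 1 else 2)"
proof -
  define p where "p = (if a + 1 = int n then 0 else a + 1)"
  define q where "q = (if a = 0 then int n - 1 else a - 1)"
  have range: "0 \<le> p" "p < int n" "0 \<le> q" "q < int n"
    using assms by (auto simp: p_def q_def)
  have "{b. 0 \<le> b \<and> b < int n \<and> cycle_adj n a b} = {p, q}"
  proof (intro set_eqI)
    fix b
    show "b \<in> {b. 0 \<le> b \<and> b < int n \<and> cycle_adj n a b} \<longleftrightarrow> b \<in> {p, q}"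
      using cycle_adj_iff[OF assms, of b] range unfolding p_def[symmetric] q_def[symmetric] by blast
  qed
  moreover have "p = q \<longleftrightarrow> n = 2" using assms by (auto simp: p_def q_def)
  ultimately show ?thesis by (cases "n = 2") auto
qed

lemma torus_adj_irrefl: "\<not> torus_adj n x x"
  by (simp add: torus_adj_def cycle_adj_def)

lemma torus_adj_sym: "torus_adj n x y \<Longrightarrow> torus_adj n y x"
  unfolding torus_adj_def cycle_adj_def by metis

text \<open>The neighbours of \<open>x\<close> split into disjoint classes according to the coordinate in which they differ from \<open>x\<close>.\<close>
lemma graph_degree_torus:
  assumes n: "2 \<le> n" and x: "x \<in> (torus n :: (int ^ 'd::finite) set)"
  shows "graph_degree (torus n) (torus_adj n) x = CARD('d) * (if n = 2 then 1 else 2)"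
proof -
  define move where "move i b = (\<chi> j. if j = i then b else x $ j)" for i b
  define nb where "nb i = {b. 0 \<le> b \<and> b < int n \<and> cycle_adj n (x $ i) b}" for i
  have "{y \<in> torus n. torus_adj n x y} = (\<Union>i. move i ` nb i)"
  proof (intro set_eqI iffI)
    fix y assume "y \<in> {y \<in> torus n. torus_adj n x y}"
    then obtain i where i: "cycle_adj n (x $ i) (y $ i)" "\<And>j. j \<noteq> i \<Longrightarrow> x $ j = y $ j" and y: "y \<in> torus n"
      by (auto simp: torus_adj_def)
    have "y = move i (y $ i)" using i by (auto simp: move_def vec_eq_iff)
    moreover have "y $ i \<in> nb i" using i y by (simp add: nb_def torus_def)
    ultimately show "y \<in> (\<Union>i. move i ` nb i)" by blast
  next
    fix y assume "y \<in> (\<Union>i. move i ` nb i)"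
    then obtain i b where "b \<in> nb i" "y = move i b" by blast
    then show "y \<in> {y \<in> torus n. torus_adj n x y}"
      using x by (auto simp: nb_def move_def torus_def torus_adj_def intro!: exI[of _ i])
  qed
  moreover have "move i ` nb i \<inter> move j ` nb j = {}" if "i \<noteq> j" for i j
  proof -
    have "move i b \<noteq> move j c" if "b \<in> nb i" for b c
    proof
      assume "move i b = move j c"
      then have "b = x $ i" using \<open>i \<noteq> j\<close> by (auto simp: move_def vec_eq_iff dest: spec[of _ i])
      then show False using that by (simp add: nb_def cycle_adj_def)
    qed
    then show ?thesis by blast
  qed
  moreover have "card (move i ` nb i) = (if n = 2 then 1 else 2)" for i
  proof -
    have "inj_on (move i) (nb i)" by (auto simp: inj_on_def move_def vec_eq_iff split: if_splits)
    then show ?thesis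
      using card_cycle_neighbours[OF n, of "x $ i"] x by (simp add: card_image nb_def torus_def)
  qed
  moreover have "finite (nb i)" for i
    by (rule finite_subset[of _ "{0..<int n}"]) (auto simp: nb_def)
  ultimately show ?thesis
    unfolding graph_degree_def by (simp add: card_UN_disjoint)
qed

text \<open>Lower a positive coordinate by one; the sum of the coordinates decreases.\<close>
lemma torus_connected_to_zero:
  fixes x :: "int ^ 'd::finite"
  assumes n: "2 \<le> n" and "x \<in> torus n"
  shows "(\<lambda>x y. y \<in> torus n \<and> torus_adj n x y)\<^sup>*\<^sup>* x 0 \<and> (\<lambda>x y. y \<in> torus n \<and> torus_adj n x y)\<^sup>*\<^sup>* 0 x"
  using assms(2)
proof (induction "\<Sum>i\<in>UNIV. nat (x $ i)" arbitrary: x rule: less_induct)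
  case less
  let ?R = "\<lambda>x y. y \<in> torus n \<and> torus_adj n x y"
  show ?case
  proof (cases "x = 0")
    case False
    then obtain i where "x $ i \<noteq> 0" by (auto simp: vec_eq_iff)
    then have i: "0 < x $ i" "x $ i < int n" using less.prems by (auto simp: torus_def le_less)
    define y where "y = (\<chi> j. if j = i then x $ i - 1 else x $ j)"
    have "0 \<le> y $ j \<and> y $ j < int n" for j
    proof (cases "j = i")
      case True
      then show ?thesis using i by (simp add: y_def)
    next
      case False
      then show ?thesis using less.prems by (simp add: y_def torus_def)
    qed
    then have y: "y \<in> torus n" by (simp add: torus_def)
    have "cycle_adj n (x $ i) (y $ i)" using n i by (simp add: cycle_adj_iff y_def)
    then have xy: "torus_adj n x y" by (auto simp: torus_adj_def y_def)
    have "(\<Sum>i\<in>UNIV. nat (y $ i)) < (\<Sum>i\<in>UNIV. nat (x $ i))"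
      using i by (intro sum_strict_mono_ex1) (auto simp: y_def)
    then have IH: "?R\<^sup>*\<^sup>* y 0" "?R\<^sup>*\<^sup>* 0 y" using less.hyps y by auto
    have "?R x y" "?R y x" using xy y less.prems torus_adj_sym by auto
    then show ?thesis
      using converse_rtranclp_into_rtranclp[of ?R x y 0] rtranclp.rtrancl_into_rtrancl[of ?R 0 y x] IH
      by simp
  qed simp
qed

lemma regular_graph_torus:
  assumes n: "2 \<le> n"
  shows "regular_graph (torus n :: (int ^ 'd::finite) set) (torus_adj n) (CARD('d) * (if n = 2 then 1 else 2))"
proof
  show "finite (torus n :: (int ^ 'd) set)"
    by (rule card_ge_0_finite) (use n in \<open>simp add: card_torus\<close>)
  show "\<not> torus_adj n v v" for v :: "int ^ 'd"
    by (rule torus_adj_irrefl)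
  show "(\<lambda>x y. y \<in> torus n \<and> torus_adj n x y)\<^sup>*\<^sup>* u w"
    if "u \<in> torus n" "w \<in> torus n" for u w :: "int ^ 'd"
    using torus_connected_to_zero[OF n that(1)] torus_connected_to_zero[OF n that(2)]
    by (meson rtranclp_trans)
qed (use n in \<open>auto simp: graph_degree_torus torus_adj_sym\<close>)

lemma reduce_in_torus: "0 < n \<Longrightarrow> reduce n x \<in> torus n"
  by (simp add: reduce_def torus_def)

lemma eventually_reduce_neq:
  fixes x y :: "int ^ 'd::finite"
  assumes "x \<noteq> y"
  shows "\<forall>\<^sub>F n in sequentially. reduce n x \<noteq> reduce n y"
proof -
  obtain i where i: "x $ i \<noteq> y $ i" using assms by (auto simp: vec_eq_iff)
  show ?thesis
    using eventually_gt_at_top[of "nat \<bar>x $ i - y $ i\<bar>"]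
  proof eventually_elim
    case (elim n)
    have "\<not> int n dvd x $ i - y $ i"
      using i elim dvd_imp_le_int[of "x $ i - y $ i" "int n"] by auto
    then show ?case by (auto simp: reduce_def vec_eq_iff mod_eq_dvd_iff)
  qed
qed

section \<open>Moments of the meteor process on the torus\<close>

theorem theorem5p1:
  fixes \<Omega> :: "nat \<Rightarrow> 'a measure"
    and N :: "nat \<Rightarrow> int ^ 'd::finite \<Rightarrow> real \<Rightarrow> 'a \<Rightarrow> nat"
    and M :: "nat \<Rightarrow> real \<Rightarrow> int ^ 'd \<Rightarrow> 'a \<Rightarrow> real"
    and Q :: "nat \<Rightarrow> (int ^ 'd \<Rightarrow> real) measure"
  assumes "\<And>n. n \<ge> 2 \<Longrightarrow>
    stationary_meteor_process (\<Omega> n) (torus n) (torus_adj n) (N n) (M n) (real (n ^ CARD('d))) (Q n)"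
  shows "(\<forall>n\<ge>2. \<forall>x\<in>torus n. prob_space.expectation (Q n) (\<lambda>m. m x) = 1) \<and>
    (\<forall>x :: int ^ 'd.
      (\<lambda>n. prob_space.variance (Q n) (\<lambda>m. m (reduce n x))) \<longlonglongrightarrow> 1) \<and>
    (\<forall>x y :: int ^ 'd. (\<forall>\<^sub>F n in sequentially. torus_adj n (reduce n x) (reduce n y)) \<longrightarrow>
      (\<lambda>n. covariance (Q n) (\<lambda>m. m (reduce n x)) (\<lambda>m. m (reduce n y)))
        \<longlonglongrightarrow> - 1 / (2 * real CARD('d))) \<and>
    (\<forall>x y :: int ^ 'd. x \<noteq> y \<and>
        (\<forall>\<^sub>F n in sequentially. \<not> torus_adj n (reduce n x) (reduce n y)) \<longrightarrow>
      (\<lambda>n. covariance (Q n) (\<lambda>m. m (reduce n x)) (\<lambda>m. m (reduce n y))) \<longlonglongrightarrow> 0)"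
proof (intro conjI allI ballI impI)
  let ?D = "\<lambda>n::nat. CARD('d) * (if n = 2 then 1 else 2)"
  have graph: "regular_graph (torus n :: (int ^ 'd) set) (torus_adj n) (?D n)" if "2 \<le> n" for n
    using that by (rule regular_graph_torus)
  have st: "stationary_meteor_process (\<Omega> n) (torus n) (torus_adj n) (N n) (M n)
      (real (card (torus n :: (int ^ 'd) set))) (Q n)" if "2 \<le> n" for n
    using assms[OF that] by (simp add: card_torus)
  show "prob_space.expectation (Q n) (\<lambda>m. m x) = 1" if "2 \<le> n" "x \<in> torus n" for n and x :: "int ^ 'd"
    by (rule regular_graph.mean_mass[OF graph st]) (use that in auto)
  have cov: "\<forall>\<^sub>F n in sequentially. covariance (Q n) (\<lambda>m. m (reduce n x)) (\<lambda>m. m (reduce n y))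
      = of_bool (reduce n x = reduce n y)
        - of_bool (torus_adj n (reduce n x) (reduce n y)) / (2 * real CARD('d))" for x y :: "int ^ 'd"
    \<comment> \<open>For \<open>n = 2\<close> the torus is only \<open>d\<close>-regular.\<close>
    using eventually_ge_at_top[of 3]
  proof eventually_elim
    case (elim n)
    then have n: "2 \<le> n" by simp
    show ?case
      using regular_graph.stationary_covariance[OF graph[OF n] st[OF n], of "reduce n x" "reduce n y"] elim
      by (simp add: reduce_in_torus mult.commute)
  qed
  show "(\<lambda>n. prob_space.variance (Q n) (\<lambda>m. m (reduce n x))) \<longlonglongrightarrow> 1" for x :: "int ^ 'd"
  proof (rule tendsto_eventually)
    show "\<forall>\<^sub>F n in sequentially. prob_space.variance (Q n) (\<lambda>m. m (reduce n x)) = 1"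
      using cov[of x x]
    proof eventually_elim
      case (elim n)
      have "covariance (Q n) (\<lambda>m. m (reduce n x)) (\<lambda>m. m (reduce n x)) = 1"
        using elim torus_adj_irrefl[of n "reduce n x"] by simp
      then show ?case unfolding covariance_def power2_eq_square .
    qed
  qed
  show "(\<lambda>n. covariance (Q n) (\<lambda>m. m (reduce n x)) (\<lambda>m. m (reduce n y)))
      \<longlonglongrightarrow> - 1 / (2 * real CARD('d))"
    if "\<forall>\<^sub>F n in sequentially. torus_adj n (reduce n x) (reduce n y)" for x y :: "int ^ 'd"
  proof (rule tendsto_eventually)
    show "\<forall>\<^sub>F n in sequentially. covariance (Q n) (\<lambda>m. m (reduce n x)) (\<lambda>m. m (reduce n y))
        = - 1 / (2 * real CARD('d))"
      using cov[of x y] that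
    proof eventually_elim
      case (elim n)
      have "reduce n x \<noteq> reduce n y" using elim(2) torus_adj_irrefl[of n "reduce n x"] by metis
      then show ?case using elim by simp
    qed
  qed
  show "(\<lambda>n. covariance (Q n) (\<lambda>m. m (reduce n x)) (\<lambda>m. m (reduce n y))) \<longlonglongrightarrow> 0"
    if "x \<noteq> y \<and> (\<forall>\<^sub>F n in sequentially. \<not> torus_adj n (reduce n x) (reduce n y))" for x y :: "int ^ 'd"
  proof (rule tendsto_eventually)
    show "\<forall>\<^sub>F n in sequentially. covariance (Q n) (\<lambda>m. m (reduce n x)) (\<lambda>m. m (reduce n y)) = 0"
      using cov[of x y] conjunct2[OF that] eventually_reduce_neq[OF conjunct1[OF that]]
      by eventually_elim simp
  qed
qed

end
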